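(* Let $G$ be a finite group, and let $\mathcal{SN}(G)=\{H\leq G \mid N_G(H)=H\}$ be the set of all self-normalizing subgroups of $G$. Let $N_{\mathcal{SN}}(G)=\bigcap_{H\in\mathcal{SN}(G)}N_G(H)$. Then $N_{\mathcal{SN}}(G)=Z_{\infty}(G)$.
   Context: All groups are finite. $N_G(H)$ denotes the normalizer of $H$ in $G$. $Z_{\infty}(G)$ denotes the hypercenter of $G$, i.e. the terminal term of the upper central series of $G$. A subgroup $H$ of $G$ is self-normalizing if $H=N_G(H)$. *)

theory Defs
  imports "HOL-Algebra.Group_Action"
begin

definition group_center :: "('a, 'b) monoid_scheme \<Rightarrow> 'a set"
  where "group_center G = {z \<in> carrier G. \<forall>g \<in> carrier G. z \<otimes>\<^bsub>G\<^esub> g = g \<otimes>\<^bsub>G\<^esub> z}"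

text \<open>The next term of the series is the full preimage in \<open>G\<close> of the center of the quotient
  of \<open>G\<close> by the current term, i.e. \<open>Z\<^sub>n\<^sub>+\<^sub>1 / Z\<^sub>n = Z(G / Z\<^sub>n)\<close>.\<close>

primrec upper_central_series :: "('a, 'b) monoid_scheme \<Rightarrow> nat \<Rightarrow> 'a set"
  where
    "upper_central_series G 0 = {\<one>\<^bsub>G\<^esub>}"
  | "upper_central_series G (Suc n) =
       {x \<in> carrier G.
          upper_central_series G n #>\<^bsub>G\<^esub> x \<in> group_center (G Mod upper_central_series G n)}"

text \<open>The terminal term is the one at the first index where the series becomes stationary. Such an
  index exists for finite groups; for infinite groups the series may have to be continued
  transfinitely, and this definition is not meaningful in general.\<close>

definition hypercenter :: "('a, 'b) monoid_scheme \<Rightarrow> 'a set"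
  where "hypercenter G =
    upper_central_series G
      (LEAST n. upper_central_series G (Suc n) = upper_central_series G n)"

definition self_normalizing_subgroups :: "('a, 'b) monoid_scheme \<Rightarrow> 'a set set"
  where "self_normalizing_subgroups G = {H. subgroup H G \<and> normalizer G H = H}"

text \<open>The intersection is over a nonempty family, since \<open>carrier G\<close> is self-normalizing.\<close>

definition self_normalizing_norm :: "('a, 'b) monoid_scheme \<Rightarrow> 'a set"
  where "self_normalizing_norm G = (\<Inter>H \<in> self_normalizing_subgroups G. normalizer G H)"

end

theory Submission
  imports Defs "HOL-Algebra.Zassenhaus" "HOL-Algebra.Multiplicative_Group" "HOL-Algebra.Sylow"
begin

text \<open>
  The normalizer of a Sylow subgroup \<open>P\<close> is self-normalizing, because \<open>P\<close> contains every \<open>p\<close>-element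
  of it. Hence the left-hand side lies in the intersection \<open>M\<close> of all Sylow normalizers, and it
  remains to see that \<open>M \<subseteq> Z\<^sub>\<infinity>(G)\<close> (Baer). A \<open>p\<close>-element of \<open>M\<close> lies in every Sylow \<open>p\<close>-subgroup
  \<open>P\<close>, so \<open>N = M \<inter> P\<close> is a normal \<open>p\<close>-subgroup. For a Sylow \<open>q\<close>-subgroup \<open>Q\<close> with \<open>q \<noteq> p\<close>
  we have \<open>[N, Q] \<subseteq> N \<inter> Q = 1\<close>. If \<open>N\<close> were not inside \<open>Z\<^sub>\<infinity>(G)\<close>, then \<open>P\<close>, acting by conjugation
  on \<open>N / (N \<inter> Z\<^sub>\<infinity>(G))\<close>, would fix a nontrivial coset; its representative would commute modulo
  \<open>Z\<^sub>\<infinity>(G)\<close> with a Sylow subgroup for every prime, hence with all of \<open>G\<close>, and so lie in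
  \<open>Z\<^sub>\<infinity>(G)\<close>. Conversely, each term of the upper central series that is contained in \<open>H\<close> forces the
  next one to normalize \<open>H\<close>.
\<close>

section \<open>Fixed points of p-group actions and arithmetic of cosets\<close>

text \<open>If \<open>x0\<close> were the only fixed point in \<open>F\<close>, the other orbits in
  \<open>F\<close> would all have size divisible by \<open>p\<close>, so \<open>p\<close> would
  divide both \<open>card F\<close> and \<open>card F - 1\<close>. An invariant subset
  \<open>F\<close> is allowed because the action applied later lives on the whole power set of a
  group.\<close>

lemma (in group_action) second_fixed_point:
  assumes p: "prime p" "order G = p ^ a"
    and F: "F \<subseteq> E" "finite F" "p dvd card F"
    and inv: "\<And>g x. g \<in> carrier G \<Longrightarrow> x \<in> F \<Longrightarrow> \<phi> g x \<in> F"
    and x0: "x0 \<in> F" "\<And>g. g \<in> carrier G \<Longrightarrow> \<phi> g x0 = x0"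
  shows "\<exists>x\<in>F. x \<noteq> x0 \<and> (\<forall>g\<in>carrier G. \<phi> g x = x)"
proof (rule ccontr)
  interpret group_hom G "BijGroup E" \<phi> by (rule group_hom)
  assume no: "\<not> ?thesis"
  define C where "C = orbit G \<phi> ` (F - {x0})"
  have orb0: "orbit G \<phi> x0 = {x0}"
    using x0 orbit_refl[of x0] F by (auto simp: orbit_def)
  have sub: "orbit G \<phi> x \<subseteq> F - {x0}" if x: "x \<in> F - {x0}" for x
  proof -
    have "x0 \<notin> orbit G \<phi> x"
    proof
      assume "x0 \<in> orbit G \<phi> x"
      then have "x \<in> orbit G \<phi> x0"
        using orbit_sym[of x x0] x F x0 by auto
      with orb0 x show False by auto
    qed
    moreover have "orbit G \<phi> x \<subseteq> F"
      using inv x by (auto simp: orbit_def)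
    ultimately show ?thesis by auto
  qed
  have un: "\<Union>C = F - {x0}"
  proof
    show "\<Union>C \<subseteq> F - {x0}" using sub by (auto simp: C_def)
    show "F - {x0} \<subseteq> \<Union>C" using orbit_refl F by (auto simp: C_def)
  qed
  have "p dvd card (\<Union>C)"
  proof (rule dvd_partition)
    show "finite (\<Union>C)" using un F by auto
    show "\<forall>c\<in>C. p dvd card c"
    proof
      fix c assume "c \<in> C"
      then obtain x where x: "x \<in> F - {x0}" "c = orbit G \<phi> x" by (auto simp: C_def)
      have "card c dvd p ^ a"
        using orbit_stabilizer_theorem[of x] x F p by (metis Diff_iff dvd_triv_left subsetD)
      then obtain i where i: "card c = p ^ i"
        using divides_primepow_nat p by blast
      \<comment> \<open>A one-element orbit would be a fixed point other than
        \<open>x0\<close>.\<close>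
      have "i \<noteq> 0"
      proof
        assume "i = 0"
        then obtain y where "c = {y}" using i card_1_singletonE by auto
        moreover have "x \<in> c" using x F orbit_refl by auto
        ultimately have "orbit G \<phi> x = {x}" using x by auto
        then have "\<phi> g x = x" if "g \<in> carrier G" for g
          using that by (auto simp: orbit_def)
        then show False using no x by auto
      qed
      then show "p dvd card c" using i by (simp add: dvd_power)
    qed
    have "C \<subseteq> orbits G E \<phi>" using F by (auto simp: C_def orbits_def)
    then show "\<forall>c1\<in>C. \<forall>c2\<in>C. c1 \<noteq> c2 \<longrightarrow> c1 \<inter> c2 = {}"
      using disjoint_union by blast
  qed
  then have "p dvd card F - 1" using un x0 F by simp
  moreover have "card F > 0" using x0 F by (auto simp: card_gt_0_iff)
  ultimately have "p dvd 1" using F(3) by (metis Suc_diff_1 Suc_eq_plus1 dvd_add_right_iff)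
  then show False using p by auto
qed

text \<open>The order of the coset of \<open>x\<close> in the quotient divides both \<open>k\<close>
  and the index of \<open>H\<close>, so the coset is trivial.\<close>

lemma (in normal) mem_if_pow_mem_coprime_index:
  assumes fin: "finite (carrier G)" and x: "x \<in> carrier G"
    and pow: "x [^] (k::nat) \<in> H" and cop: "coprime k (card (rcosets H))"
  shows "x \<in> H"
proof -
  interpret Q: group "G Mod H" by (rule factorgroup_is_group)
  have Qx: "H #> x \<in> carrier (G Mod H)" using x by (auto simp: carrier_FactGroup)
  have "(H #> x) [^]\<^bsub>G Mod H\<^esub> k = \<one>\<^bsub>G Mod H\<^esub>"
    using FactGroup_pow[of x k] x pow subset by (simp add: coset_join2 subgroup_axioms)
  then have "Q.ord (H #> x) dvd k" using Q.pow_eq_id Qx by blast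
  moreover have "Q.ord (H #> x) dvd card (rcosets H)"
    using Q.ord_dvd_group_order[OF Qx] by (simp add: order_def FactGroup_def)
  ultimately have "Q.ord (H #> x) = 1"
    using cop by (metis coprime_common_divisor nat_dvd_1_iff_1)
  then have "H #> x = H" using Q.ord_eq_1 Qx by simp
  then show ?thesis using x rcos_self[OF x] subgroup_axioms by auto
qed

lemma (in normal) rcos_mult_cong:
  assumes "a \<in> carrier G" "b \<in> carrier G" "c \<in> carrier G" "H #> a = H #> b"
  shows "H #> (a \<otimes> c) = H #> (b \<otimes> c)" and "H #> (c \<otimes> a) = H #> (c \<otimes> b)"
  using assms by (simp_all add: rcos_sum[symmetric])

section \<open>Normalizers, conjugation and orders of subgroups\<close>

context group
begin

lemma mem_normalizer_iff:
  assumes "subgroup H G"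
  shows "g \<in> normalizer G H \<longleftrightarrow> g \<in> carrier G \<and> g <# H #> inv g = H"
  using subgroup.subset[OF assms] by (auto simp: normalizer_def stabilizer_def)

lemma subgroup_normalizer: "subgroup H G \<Longrightarrow> subgroup (normalizer G H) G"
  by (rule normalizer_imp_subgroup[OF subgroup.subset])

lemma normalizer_conj_closed:
  assumes "subgroup H G" "g \<in> normalizer G H" "h \<in> H"
  shows "g \<otimes> h \<otimes> inv g \<in> H"
  using assms mem_normalizer_iff[OF assms(1)] by (force simp: l_coset_def r_coset_def)

lemma subgroup_subset_normalizer:
  assumes "subgroup H G"
  shows "H \<subseteq> normalizer G H"
  using normal_imp_subgroup[OF subgroup_in_normalizer[OF assms]] subgroup.subset by fastforce

lemma card_conj:
  assumes "H \<subseteq> carrier G" "g \<in> carrier G"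
  shows "card (g <# H #> inv g) = card H"
proof -
  have "g <# H #> inv g = (\<lambda>h. g \<otimes> h \<otimes> inv g) ` H"
    by (auto simp: l_coset_def r_coset_def)
  moreover have "inj_on (\<lambda>h. g \<otimes> h \<otimes> inv g) H"
    using assms by (auto intro!: inj_onI simp: subset_iff)
  ultimately show ?thesis by (simp add: card_image)
qed

text \<open>One inclusion suffices: the conjugate of \<open>H\<close> has as many elements as
  \<open>H\<close>, and \<open>H\<close> is finite.\<close>

lemma mem_normalizerI:
  assumes fin: "finite (carrier G)" and H: "subgroup H G" and g: "g \<in> carrier G"
    and conj: "\<And>h. h \<in> H \<Longrightarrow> g \<otimes> h \<otimes> inv g \<in> H"
  shows "g \<in> normalizer G H"
proof -
  have "g <# H #> inv g \<subseteq> H" using conj by (auto simp: l_coset_def r_coset_def)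
  moreover have "finite H" using fin subgroup.subset[OF H] finite_subset by blast
  ultimately have "g <# H #> inv g = H"
    using card_conj[OF subgroup.subset[OF H] g] by (simp add: card_subset_eq)
  then show ?thesis using g H mem_normalizer_iff by blast
qed

lemma inv_mult_cancel_left:
  "x \<in> carrier G \<Longrightarrow> y \<in> carrier G \<Longrightarrow> inv x \<otimes> (x \<otimes> y) = y"
  by (simp add: m_assoc[symmetric])

lemma conj_pow:
  assumes "g \<in> carrier G" "h \<in> carrier G"
  shows "(g \<otimes> h \<otimes> inv g) [^] (n::nat) = g \<otimes> h [^] n \<otimes> inv g"
proof (induction n)
  case (Suc n)
  then show ?case using assms by (simp add: m_assoc inv_mult_cancel_left)
qed (use assms in simp)

lemma pow_card_subgroup:
  assumes "subgroup H G" "x \<in> H"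
  shows "x [^] card H = \<one>"
proof -
  interpret S: group "G\<lparr>carrier := H\<rparr>" using assms(1) by (rule subgroup_imp_group)
  have "x [^]\<^bsub>G\<lparr>carrier := H\<rparr>\<^esub> order (G\<lparr>carrier := H\<rparr>) = \<one>\<^bsub>G\<lparr>carrier := H\<rparr>\<^esub>"
    by (rule S.pow_order_eq_1) (use assms in simp)
  then show ?thesis using assms nat_pow_consistent by (simp add: order_def)
qed

lemma card_subgroup_dvd:
  assumes "subgroup H G" "subgroup K G" "H \<subseteq> K"
  shows "card H dvd card K"
proof -
  interpret S: group "G\<lparr>carrier := K\<rparr>" using assms(2) by (rule subgroup_imp_group)
  have "subgroup H (G\<lparr>carrier := K\<rparr>)" using assms subgroup_incl by blast
  from S.lagrange[OF this] have "card (rcosets\<^bsub>G\<lparr>carrier := K\<rparr>\<^esub> H) * card H = card K"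
    by (simp add: order_def)
  then show ?thesis by (metis dvd_triv_right)
qed

end

section \<open>Sylow subgroups and their normalizers\<close>

text \<open>For finite \<open>G\<close> and a prime \<open>p\<close> not dividing the order, the
  exponent is 0 and the trivial subgroup qualifies, so every prime has a Sylow subgroup and no case
  distinction arises.\<close>

definition sylow_subgroup :: "('a, 'b) monoid_scheme \<Rightarrow> nat \<Rightarrow> 'a set \<Rightarrow> bool"
  where "sylow_subgroup G p P \<longleftrightarrow> subgroup P G \<and> card P = p ^ multiplicity p (order G)"

context group
begin

lemma ex_sylow_subgroup:
  assumes "finite (carrier G)" "prime p"
  shows "\<exists>P. sylow_subgroup G p P"
  using sylow_thm[OF assms(2) group_axioms _ assms(1)] multiplicity_dvd[of p "order G"]
  unfolding sylow_subgroup_def by (metis dvdE)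

lemma sylow_subgroup_conj:
  assumes "sylow_subgroup G p P" "g \<in> carrier G"
  shows "sylow_subgroup G p (g <# P #> inv g)"
  using assms card_conj subgroup_conjugation_is_surj2 subgroup.subset
  unfolding sylow_subgroup_def by metis

text \<open>\<open>P\<close> is normal in its normalizer and already carries the full
  \<open>p\<close>-part of the group order, so its index there is prime to \<open>p\<close>, and a
  \<open>p\<close>-element of the normalizer has trivial coset.\<close>

lemma p_element_normalizing_sylow:
  assumes fin: "finite (carrier G)" and p: "prime p" and P: "sylow_subgroup G p P"
    and x: "x \<in> normalizer G P" and pow: "x [^] (p ^ k) = \<one>"
  shows "x \<in> P"
proof -
  let ?N = "normalizer G P"
  have sub: "subgroup P G" and card: "card P = p ^ multiplicity p (order G)"
    using P by (auto simp: sylow_subgroup_def)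
  have N: "subgroup ?N G" using subgroup_normalizer[OF sub] .
  interpret N: normal P "G\<lparr>carrier := ?N\<rparr>" using subgroup_in_normalizer[OF sub] .
  define i where "i = card (rcosets\<^bsub>G\<lparr>carrier := ?N\<rparr>\<^esub> P)"
  have o: "order G > 0" using fin order_gt_0_iff_finite by blast
  have "i * card P = card ?N"
    using N.lagrange[OF N.subgroup_axioms] by (simp add: i_def order_def)
  then have 1: "i * p ^ multiplicity p (order G) dvd order G"
    using card card_subgroup_dvd[OF N subgroup_self] subgroup.subset[OF N] by (simp add: order_def)
  have "\<not> p dvd i"
  proof (intro notI)
    assume "p dvd i"
    then have "p ^ Suc (multiplicity p (order G)) dvd i * p ^ multiplicity p (order G)"
      by (simp add: mult_dvd_mono)
    then have "p ^ Suc (multiplicity p (order G)) dvd order G" using 1 dvd_trans by blast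
    then show False using o p power_dvd_iff_le_multiplicity[of "order G" p]
      by (metis Suc_n_not_le_n gr_implies_not0 not_prime_unit)
  qed
  then have "coprime (p ^ k) i" using p by (simp add: prime_imp_coprime)
  moreover have "x [^]\<^bsub>G\<lparr>carrier := ?N\<rparr>\<^esub> (p ^ k) \<in> P"
    using pow sub subgroup.one_closed nat_pow_consistent by metis
  ultimately show ?thesis
    using N.mem_if_pow_mem_coprime_index[of x "p ^ k"] x fin subgroup.subset[OF N] finite_subset
    by (auto simp: i_def)
qed

text \<open>If \<open>g\<close> normalizes \<open>normalizer G P\<close>, it conjugates each element
  of \<open>P\<close> to a \<open>p\<close>-element of that normalizer. All of these lie in
  \<open>P\<close>, so \<open>g\<close> normalizes \<open>P\<close>.\<close>

lemma normalizer_sylow_self_normalizing: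
  assumes fin: "finite (carrier G)" and p: "prime p" and P: "sylow_subgroup G p P"
  shows "normalizer G P \<in> self_normalizing_subgroups G"
proof -
  have sub: "subgroup P G" and card: "card P = p ^ multiplicity p (order G)"
    using P by (auto simp: sylow_subgroup_def)
  have N: "subgroup (normalizer G P) G" using subgroup_normalizer[OF sub] .
  have "g \<in> normalizer G P" if g: "g \<in> normalizer G (normalizer G P)" for g
  proof (rule mem_normalizerI[OF fin sub])
    show gG: "g \<in> carrier G" using g N mem_normalizer_iff by blast
    fix h assume h: "h \<in> P"
    then have hG: "h \<in> carrier G" using sub subgroup.subset by blast
    have "(g \<otimes> h \<otimes> inv g) [^] (p ^ multiplicity p (order G)) = \<one>"
      using conj_pow[OF gG hG] pow_card_subgroup[OF sub h] card gG by simp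
    moreover have "g \<otimes> h \<otimes> inv g \<in> normalizer G P"
      using normalizer_conj_closed[OF N g] subgroup_subset_normalizer[OF sub] h by blast
    ultimately show "g \<otimes> h \<otimes> inv g \<in> P"
      using p_element_normalizing_sylow[OF fin p P] by blast
  qed
  then show ?thesis
    using N subgroup_subset_normalizer[OF N] by (auto simp: self_normalizing_subgroups_def)
qed

text \<open>By Lagrange, each prime power in \<open>order G\<close> divides \<open>card H\<close>,
  hence so does \<open>order G\<close>. This reduces statements about all of \<open>G\<close> to one
  Sylow subgroup per prime.\<close>

lemma eq_carrier_if_contains_sylows:
  assumes fin: "finite (carrier G)" and H: "subgroup H G"
    and syl: "\<And>p. prime p \<Longrightarrow> \<exists>P\<subseteq>H. sylow_subgroup G p P"
  shows "H = carrier G"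
proof -
  have o: "order G > 0" using fin order_gt_0_iff_finite by blast
  have finH: "finite H" using fin subgroup.subset[OF H] finite_subset by blast
  then have cH: "card H > 0" using subgroup.one_closed[OF H] by (auto simp: card_gt_0_iff)
  have "order G dvd card H"
  proof (rule multiplicity_le_imp_dvd)
    fix p :: nat assume p: "prime p"
    then obtain P where P: "P \<subseteq> H" "subgroup P G" "card P = p ^ multiplicity p (order G)"
      using syl unfolding sylow_subgroup_def by blast
    then have "p ^ multiplicity p (order G) dvd card H" using card_subgroup_dvd H by metis
    then show "multiplicity p (order G) \<le> multiplicity p (card H)"
      using cH p power_dvd_iff_le_multiplicity[of _ p] not_prime_unit by blast
  qed (use o in simp)
  then have "card (carrier G) \<le> card H" using cH dvd_imp_le by (simp add: order_def)
  then show ?thesis using fin subgroup.subset[OF H] by (simp add: card_seteq)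
qed

section \<open>Commuting modulo a normal subgroup\<close>

text \<open>The commutator is \<open>x\<close> times a conjugate of \<open>inv x\<close>, a product
  of two elements of \<open>N\<close>.\<close>

lemma normal_commutator_closed:
  assumes "N \<lhd> G" "x \<in> N" "g \<in> carrier G"
  shows "x \<otimes> g \<otimes> inv x \<otimes> inv g \<in> N"
proof -
  have N: "subgroup N G" using assms normal_imp_subgroup by blast
  have x: "x \<in> carrier G" using N assms subgroup.subset by blast
  have "g \<otimes> inv x \<otimes> inv g \<in> N"
    using normal_invE(2)[OF assms(1) assms(3)] subgroup.m_inv_closed[OF N] assms by blast
  then have "x \<otimes> (g \<otimes> inv x \<otimes> inv g) \<in> N" using subgroup.m_closed[OF N] assms by blast
  then show ?thesis using x assms(3) by (simp add: m_assoc)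
qed

lemma rcos_eq_iff:
  assumes "subgroup H G" "x \<in> carrier G" "y \<in> carrier G"
  shows "H #> x = H #> y \<longleftrightarrow> x \<otimes> inv y \<in> H"
proof
  assume "H #> x = H #> y"
  then have "x \<in> H #> y" using rcos_self assms by blast
  then show "x \<otimes> inv y \<in> H" using assms subgroup.rcos_module_imp[OF _ group_axioms] by blast
next
  assume "x \<otimes> inv y \<in> H"
  then have "x \<in> H #> y" using assms subgroup.rcos_module_rev[OF _ group_axioms] by blast
  then show "H #> x = H #> y" using repr_independence assms by metis
qed

lemma normal_conj_rcos:
  assumes K: "K \<lhd> G" and "g \<in> carrier G" "x \<in> carrier G"
  shows "g <# (K #> x) #> inv g = K #> (g \<otimes> x \<otimes> inv g)"
proof -
  have sub: "K \<subseteq> carrier G" using K normal_imp_subgroup subgroup.subset by blast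
  have "g <# (K #> x) = (g <# K) #> x" using assms sub coset_assoc by simp
  also have "\<dots> = K #> g #> x" using normal.coset_eq[OF K] assms by simp
  finally show ?thesis using assms sub by (simp add: coset_mult_assoc)
qed

text \<open>\<open>P\<close> acts by conjugation on the cosets of \<open>K\<close> in
  \<open>N\<close>. Their number is a power of \<open>p\<close> greater than 1, and \<open>K\<close>
  itself is fixed, so another coset \<open>K #> x\<close> is fixed too. Being fixed by
  \<open>g\<close> means that \<open>x\<close> and \<open>g\<close> commute modulo
  \<open>K\<close>.\<close>

lemma p_group_fixes_coset:
  assumes fin: "finite (carrier G)" and p: "prime p"
    and P: "subgroup P G" "card P = p ^ a"
    and N: "N \<lhd> G" "N \<subseteq> P" and K: "K \<lhd> G" "K \<subset> N"
  shows "\<exists>x\<in>N - K. \<forall>g\<in>P. K #> (x \<otimes> g) = K #> (g \<otimes> x)"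
proof -
  \<comment> \<open>Conjugation acts on all subsets of \<open>G\<close>; the cosets of
    \<open>K\<close> in \<open>N\<close> enter as the invariant subset \<open>F\<close>.\<close>
  let ?c = "\<lambda>g. \<lambda>H \<in> {H. H \<subseteq> carrier G}. g <# H #> (inv g)"
  interpret A: group_action "G\<lparr>carrier := P\<rparr>" "{H. H \<subseteq> carrier G}" ?c
    by (rule group_action.induced_action[OF action_by_conjugation_on_power_set P(1)])
  have sN: "subgroup N G" and sK: "subgroup K G"
    using N K normal_imp_subgroup by auto
  have cN: "N \<subseteq> carrier G" and cK: "K \<subseteq> carrier G" and cP: "P \<subseteq> carrier G"
    using sN sK P(1) subgroup.subset by auto
  interpret N: group "G\<lparr>carrier := N\<rparr>" using sN by (rule subgroup_imp_group)
  define F where "F = (\<lambda>x. K #> x) ` N"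
  have FE: "F \<subseteq> {H. H \<subseteq> carrier G}"
    unfolding F_def using r_coset_subset_G[OF cK] cN by blast
  have "subgroup K (G\<lparr>carrier := N\<rparr>)" using subgroup_incl sK sN K by blast
  moreover have "rcosets\<^bsub>G\<lparr>carrier := N\<rparr>\<^esub> K = F" by (auto simp: RCOSETS_def F_def)
  ultimately have idx: "card F * card K = card N"
    using N.lagrange[of K] by (simp add: order_def)
  have finN: "finite N" using fin cN finite_subset by blast
  have "card F dvd p ^ a"
    using idx card_subgroup_dvd[OF sN P(1) N(2)] P(2) by (metis dvd_trans dvd_triv_left)
  then obtain i where i: "card F = p ^ i" using divides_primepow_nat p by blast
  have "card K < card N" using K finN psubset_card_mono by blast
  then have "i \<noteq> 0" using idx i by (cases i) auto
  then have pF: "p dvd card F" using i by (simp add: dvd_power)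
  have conj: "?c g (K #> x) = K #> (g \<otimes> x \<otimes> inv g)" if "g \<in> P" "x \<in> N" for g x
    using that normal_conj_rcos[OF K(1), of g x] cN cP r_coset_subset_G[OF cK, of x]
    by (simp add: subset_iff)
  have K0: "K = K #> \<one>" using cK by simp
  have "\<exists>A\<in>F. A \<noteq> K \<and> (\<forall>g\<in>carrier (G\<lparr>carrier := P\<rparr>). ?c g A = A)"
  proof (rule A.second_fixed_point[OF p _ FE _ pF])
    show "order (G\<lparr>carrier := P\<rparr>) = p ^ a" using P(2) by (simp add: order_def)
    show "finite F" using finN by (simp add: F_def)
    show "?c g x \<in> F" if "g \<in> carrier (G\<lparr>carrier := P\<rparr>)" "x \<in> F" for g x
    proof -
      obtain y where y: "y \<in> N" "x = K #> y" using \<open>x \<in> F\<close> by (auto simp: F_def)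
      have "g \<otimes> y \<otimes> inv g \<in> N" using normal_invE(2)[OF N(1)] that y cP by auto
      then show ?thesis using conj[of g y] that y by (auto simp: F_def)
    qed
    show "K \<in> F" using K0 subgroup.one_closed[OF sN] by (auto simp: F_def)
    show "?c g K = K" if "g \<in> carrier (G\<lparr>carrier := P\<rparr>)" for g
    proof -
      have gP: "g \<in> P" and gG: "g \<in> carrier G" using that cP by auto
      have "?c g (K #> \<one>) = K #> \<one>"
        using conj[OF gP subgroup.one_closed[OF sN]] gG by (simp del: coset_mult_one)
      then show ?thesis using K0 by simp
    qed
  qed
  then obtain x where x: "x \<in> N" "K #> x \<noteq> K" "\<And>g. g \<in> P \<Longrightarrow> ?c g (K #> x) = K #> x"
    by (auto simp: F_def)
  have "x \<notin> K" using x(2) coset_join2[OF _ sK] cK by blast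
  moreover have "K #> (x \<otimes> g) = K #> (g \<otimes> x)" if g: "g \<in> P" for g
  proof -
    have c: "x \<in> carrier G" "g \<in> carrier G" using x(1) g cN cP by auto
    have "K #> x = K #> (g \<otimes> x \<otimes> inv g)" using conj[OF g x(1)] x(3)[OF g] by simp
    then have "K #> x #> g = K #> (g \<otimes> x \<otimes> inv g) #> g" by simp
    then show ?thesis using c cK by (simp add: coset_mult_assoc m_assoc)
  qed
  ultimately show ?thesis using x(1) by blast
qed

text \<open>This set is the preimage of the centralizer of the coset of \<open>x\<close> in the
  quotient by \<open>K\<close>.\<close>

lemma subgroup_commuting_mod:
  assumes K: "K \<lhd> G" and x: "x \<in> carrier G"
  shows "subgroup {g \<in> carrier G. K #> (x \<otimes> g) = K #> (g \<otimes> x)} G"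
proof -
  interpret K: normal K G by (rule K)
  have step: "K #> (x \<otimes> (g \<otimes> h)) = K #> (g \<otimes> h \<otimes> x)"
    if "g \<in> carrier G" "h \<in> carrier G" "K #> (x \<otimes> g) = K #> (g \<otimes> x)" "K #> (x \<otimes> h) = K #> (h \<otimes> x)" for g h
    using K.rcos_mult_cong(1)[of "x \<otimes> g" "g \<otimes> x" h] K.rcos_mult_cong(2)[of "x \<otimes> h" "h \<otimes> x" g] that x
    by (simp add: m_assoc)
  have inv: "K #> (x \<otimes> inv g) = K #> (inv g \<otimes> x)"
    if g: "g \<in> carrier G" "K #> (x \<otimes> g) = K #> (g \<otimes> x)" for g
  proof -
    have "K #> (inv g \<otimes> (x \<otimes> g)) = K #> x"
      using K.rcos_mult_cong(2)[of "x \<otimes> g" "g \<otimes> x" "inv g"] g x by (simp add: inv_mult_cancel_left)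
    from K.rcos_mult_cong(1)[OF _ _ _ this, of "inv g"] show ?thesis
      using g(1) x by (simp add: m_assoc)
  qed
  show ?thesis
    by (rule subgroupI) (use step inv x in \<open>auto intro: exI[of _ \<one>]\<close>)
qed

section \<open>The upper central series and the hypercenter\<close>

text \<open>Normality turns products of cosets into cosets of products. It is a hypothesis because
  the induction that proves it for all terms relies on this equivalence.\<close>

lemma upper_central_series_Suc_iff:
  assumes Z: "upper_central_series G n \<lhd> G"
  shows "x \<in> upper_central_series G (Suc n) \<longleftrightarrow> x \<in> carrier G \<and>
    (\<forall>g\<in>carrier G. upper_central_series G n #> (x \<otimes> g) = upper_central_series G n #> (g \<otimes> x))"
proof -
  interpret Z: normal "upper_central_series G n" G by (rule Z)
  show ?thesis
    by (auto simp: group_center_def carrier_FactGroup Z.rcos_sum)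
qed

text \<open>The next term is the intersection, over all \<open>g\<close>, of the subgroups of
  elements commuting with \<open>g\<close> modulo the current term. It is normal since a conjugate
  of one of its elements \<open>x\<close> lies in the same coset as \<open>x\<close>.\<close>

lemma upper_central_series_normal: "upper_central_series G n \<lhd> G"
proof (induction n)
  case 0
  then show ?case using one_is_normal by simp
next
  case (Suc n)
  let ?Z = "upper_central_series G n"
  let ?Y = "upper_central_series G (Suc n)"
  interpret Z: normal ?Z G by (rule Suc)
  note iff = upper_central_series_Suc_iff[OF Suc]
  have "?Y = \<Inter>((\<lambda>g. {x \<in> carrier G. ?Z #> (g \<otimes> x) = ?Z #> (x \<otimes> g)}) ` carrier G)"
    using iff by auto
  moreover have "subgroup \<dots> G"
    by (rule subgroups_Inter) (use subgroup_commuting_mod[OF Suc] in auto)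
  ultimately have sub: "subgroup ?Y G" by simp
  show ?case
  proof (rule normal_invI[OF sub])
    fix g x assume g: "g \<in> carrier G" and x: "x \<in> ?Y"
    then have xG: "x \<in> carrier G" using sub subgroup.subset by blast
    have eq: "?Z #> (g \<otimes> x \<otimes> inv g) = ?Z #> x"
      using Z.rcos_mult_cong(1)[of "g \<otimes> x" "x \<otimes> g" "inv g"] iff x g xG by (simp add: m_assoc)
    have "?Z #> (g \<otimes> x \<otimes> inv g \<otimes> h) = ?Z #> (h \<otimes> (g \<otimes> x \<otimes> inv g))" if h: "h \<in> carrier G" for h
      using Z.rcos_mult_cong[OF _ _ _ eq, of h] iff x g xG h by simp
    then show "g \<otimes> x \<otimes> inv g \<in> ?Y" using iff g xG by simp
  qed
qed

text \<open>Commutators of elements of a normal subgroup with elements of \<open>G\<close> stay in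
  that subgroup, so its elements are central modulo it.\<close>

lemma upper_central_series_mono: "upper_central_series G n \<subseteq> upper_central_series G (Suc n)"
proof
  fix x assume x: "x \<in> upper_central_series G n"
  note Z = upper_central_series_normal[of n]
  have sub: "subgroup (upper_central_series G n) G" using Z normal_imp_subgroup by blast
  have xG: "x \<in> carrier G" using x sub subgroup.subset by blast
  have "upper_central_series G n #> (x \<otimes> g) = upper_central_series G n #> (g \<otimes> x)"
    if g: "g \<in> carrier G" for g
    using rcos_eq_iff[OF sub, of "x \<otimes> g" "g \<otimes> x"] normal_commutator_closed[OF Z x g] xG g
    by (simp add: inv_mult_group m_assoc)
  then show "x \<in> upper_central_series G (Suc n)"
    using upper_central_series_Suc_iff[OF Z] xG by blast
qed

text \<open>Otherwise the series grows strictly and its term \<open>n\<close> has at least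
  \<open>n\<close> elements. Hence the \<open>LEAST\<close> in \<open>hypercenter\<close> is
  attained.\<close>

lemma upper_central_series_stationary:
  assumes fin: "finite (carrier G)"
  shows "\<exists>n. upper_central_series G (Suc n) = upper_central_series G n"
proof (rule ccontr)
  assume "\<not> ?thesis"
  then have lt: "upper_central_series G n \<subset> upper_central_series G (Suc n)" for n
    using upper_central_series_mono[of n] by blast
  have sub: "upper_central_series G n \<subseteq> carrier G" for n
    using upper_central_series_normal normal_imp_subgroup subgroup.subset by blast
  have "n \<le> card (upper_central_series G n)" for n
  proof (induction n)
    case (Suc n)
    have "card (upper_central_series G n) < card (upper_central_series G (Suc n))"
      using lt sub fin finite_subset psubset_card_mono by metis
    then show ?case using Suc by simp
  qed simp
  moreover have "card (upper_central_series G n) \<le> card (carrier G)" for n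
    using sub fin card_mono by blast
  ultimately show False using le_trans not_less_eq_eq by blast
qed

lemma hypercenter_normal: "hypercenter G \<lhd> G"
  by (simp add: hypercenter_def upper_central_series_normal)

text \<open>The series is stationary at the hypercenter, so the quotient by it has trivial
  center.\<close>

lemma mem_hypercenterI:
  assumes fin: "finite (carrier G)" and x: "x \<in> carrier G"
    and comm: "\<And>g. g \<in> carrier G \<Longrightarrow> hypercenter G #> (x \<otimes> g) = hypercenter G #> (g \<otimes> x)"
  shows "x \<in> hypercenter G"
  using LeastI_ex[OF upper_central_series_stationary[OF fin]]
    upper_central_series_Suc_iff[OF upper_central_series_normal] x comm
  unfolding hypercenter_def by blast

text \<open>For \<open>x\<close> in the next term and \<open>h\<close> in \<open>H\<close>, the
  commutator of \<open>x\<close> and \<open>h\<close> lies in the current term, hence in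
  \<open>H\<close> by induction. Multiplying it by \<open>h\<close> gives the conjugate of
  \<open>h\<close> by \<open>x\<close>, so \<open>x\<close> normalizes \<open>H\<close> and
  therefore lies in \<open>H\<close>.\<close>

lemma upper_central_series_subset_self_normalizing:
  assumes fin: "finite (carrier G)" and H: "H \<in> self_normalizing_subgroups G"
  shows "upper_central_series G n \<subseteq> H"
proof (induction n)
  case 0
  then show ?case using H subgroup.one_closed by (auto simp: self_normalizing_subgroups_def)
next
  case (Suc n)
  have sub: "subgroup H G" and eq: "normalizer G H = H"
    using H by (auto simp: self_normalizing_subgroups_def)
  note Z = upper_central_series_normal[of n]
  have sZ: "subgroup (upper_central_series G n) G" using Z normal_imp_subgroup by blast
  show ?case
  proof
    fix x assume x: "x \<in> upper_central_series G (Suc n)"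
    note iff = upper_central_series_Suc_iff[OF Z, of x]
    have xG: "x \<in> carrier G" using x iff by blast
    have "x \<in> normalizer G H"
    proof (rule mem_normalizerI[OF fin sub xG])
      fix h assume h: "h \<in> H"
      then have hG: "h \<in> carrier G" using sub subgroup.subset by blast
      have "x \<otimes> h \<otimes> inv (h \<otimes> x) \<in> upper_central_series G n"
        using rcos_eq_iff[OF sZ] x iff hG by simp
      then have "x \<otimes> h \<otimes> inv (h \<otimes> x) \<otimes> h \<in> H" using Suc h subgroup.m_closed[OF sub] by blast
      then show "x \<otimes> h \<otimes> inv x \<in> H" using xG hG by (simp add: inv_mult_group m_assoc)
    qed
    then show "x \<in> H" using eq by simp
  qed
qed

section \<open>The intersection of the Sylow normalizers\<close>

lemma normalizer_conj:
  assumes fin: "finite (carrier G)" and P: "subgroup P G" and g: "g \<in> carrier G"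
    and x: "x \<in> normalizer G (inv g <# P #> g)"
  shows "g \<otimes> x \<otimes> inv g \<in> normalizer G P"
proof -
  have S: "subgroup (inv g <# P #> g) G" using subgroup_conjugation_is_surj1[OF g P] .
  have xG: "x \<in> carrier G" using x S mem_normalizer_iff by blast
  show ?thesis
  proof (rule mem_normalizerI[OF fin P])
    show "g \<otimes> x \<otimes> inv g \<in> carrier G" using g xG by simp
    fix h assume h: "h \<in> P"
    then have hG: "h \<in> carrier G" using P subgroup.subset by blast
    have "inv g \<otimes> h \<otimes> g \<in> inv g <# P #> g" using h by (auto simp: l_coset_def r_coset_def)
    then have "x \<otimes> (inv g \<otimes> h \<otimes> g) \<otimes> inv x \<in> inv g <# P #> g"
      using normalizer_conj_closed[OF S x] by blast
    then obtain k where k: "k \<in> P" "x \<otimes> (inv g \<otimes> h \<otimes> g) \<otimes> inv x = inv g \<otimes> k \<otimes> g"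
      by (auto simp: l_coset_def r_coset_def)
    have kG: "k \<in> carrier G" using k P subgroup.subset by blast
    have "g \<otimes> x \<otimes> inv g \<otimes> h \<otimes> inv (g \<otimes> x \<otimes> inv g)
        = g \<otimes> (x \<otimes> (inv g \<otimes> h \<otimes> g) \<otimes> inv x) \<otimes> inv g"
      using g xG hG by (simp add: inv_mult_group m_assoc)
    also have "\<dots> = k" unfolding k(2) using conjugation_is_surj g kG by simp
    finally show "g \<otimes> x \<otimes> inv g \<otimes> h \<otimes> inv (g \<otimes> x \<otimes> inv g) \<in> P" using k by simp
  qed
qed

end

text \<open>For finite \<open>G\<close>, Baer's theorem identifies this subgroup with the
  hypercenter.\<close>

definition sylow_normalizer_inter :: "('a, 'b) monoid_scheme \<Rightarrow> 'a set"
  where "sylow_normalizer_inter G =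
    {x \<in> carrier G. \<forall>p P. prime p \<longrightarrow> sylow_subgroup G p P \<longrightarrow> x \<in> normalizer G P}"

context group
begin

text \<open>Conjugation permutes the Sylow \<open>p\<close>-subgroups and with them their
  normalizers.\<close>

lemma sylow_normalizer_inter_normal:
  assumes fin: "finite (carrier G)"
  shows "sylow_normalizer_inter G \<lhd> G"
proof (rule normal_invI)
  \<comment> \<open>Inserting \<open>carrier G\<close> accounts for the carrier condition in the
    definition and makes the family visibly nonempty.\<close>
  have "sylow_normalizer_inter G = \<Inter>(insert (carrier G) {normalizer G P |p P. prime p \<and> sylow_subgroup G p P})"
    by (auto simp: sylow_normalizer_inter_def)
  moreover have "subgroup \<dots> G"
    by (rule subgroups_Inter)
      (auto simp: sylow_subgroup_def subgroup_self intro: subgroup_normalizer)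
  ultimately show "subgroup (sylow_normalizer_inter G) G" by simp
next
  fix g x assume g: "g \<in> carrier G" and x: "x \<in> sylow_normalizer_inter G"
  have "g \<otimes> x \<otimes> inv g \<in> normalizer G P" if p: "prime p" and P: "sylow_subgroup G p P" for p P
  proof -
    have "sylow_subgroup G p (inv g <# P #> g)"
      using sylow_subgroup_conj[OF P, of "inv g"] g by simp
    then have "x \<in> normalizer G (inv g <# P #> g)"
      using x p by (auto simp: sylow_normalizer_inter_def)
    then show ?thesis using normalizer_conj[OF fin _ g] P by (auto simp: sylow_subgroup_def)
  qed
  then show "g \<otimes> x \<otimes> inv g \<in> sylow_normalizer_inter G"
    using g x by (auto simp: sylow_normalizer_inter_def)
qed

lemma sylow_inter_subset_hypercenter:
  assumes fin: "finite (carrier G)" and p: "prime p" and P: "sylow_subgroup G p P"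
  shows "sylow_normalizer_inter G \<inter> P \<subseteq> hypercenter G"
proof (rule ccontr)
  define M where "M = sylow_normalizer_inter G"
  define N where "N = M \<inter> P"
  define Z where "Z = hypercenter G"
  assume "\<not> sylow_normalizer_inter G \<inter> P \<subseteq> hypercenter G"
  then have NZ: "N \<inter> Z \<subset> N" by (auto simp: N_def M_def Z_def)
  have sP: "subgroup P G" and cardP: "card P = p ^ multiplicity p (order G)"
    using P by (auto simp: sylow_subgroup_def)
  have cP: "P \<subseteq> carrier G" using sP subgroup.subset by blast
  have nM: "M \<lhd> G" using sylow_normalizer_inter_normal[OF fin] by (simp add: M_def)
  have nZ: "Z \<lhd> G" using hypercenter_normal by (simp add: Z_def)
  have Mnorm: "x \<in> normalizer G Q" if "x \<in> M" "prime q" "sylow_subgroup G q Q" for x q Q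
    using that by (auto simp: M_def sylow_normalizer_inter_def)
  have nN: "N \<lhd> G"
  proof (rule normal_invI)
    show "subgroup N G"
      using subgroups_Inter_pair[OF normal_imp_subgroup[OF nM] sP] by (simp add: N_def)
    fix g x assume g: "g \<in> carrier G" and x: "x \<in> N"
    have xG: "x \<in> carrier G" using x cP by (auto simp: N_def)
    have gx: "g \<otimes> x \<otimes> inv g \<in> M" using normal_invE(2)[OF nM g] x by (auto simp: N_def)
    \<comment> \<open>A conjugate of \<open>x\<close> is a \<open>p\<close>-element of
      \<open>M\<close>, so it normalizes \<open>P\<close> and must lie in \<open>P\<close>. Thus
      \<open>N\<close> is normal in \<open>G\<close> even if \<open>P\<close> is not.\<close>
    have "(g \<otimes> x \<otimes> inv g) [^] (p ^ multiplicity p (order G)) = \<one>"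
      using conj_pow[OF g xG] pow_card_subgroup[OF sP] x cardP g by (simp add: N_def)
    then have "g \<otimes> x \<otimes> inv g \<in> P"
      using p_element_normalizing_sylow[OF fin p P] Mnorm[OF gx p P] by blast
    then show "g \<otimes> x \<otimes> inv g \<in> N" using gx by (simp add: N_def)
  qed
  have nK: "N \<inter> Z \<lhd> G" using normal_subgroup_intersect[OF nN nZ] .
  obtain x where x: "x \<in> N" "x \<notin> Z"
    and xP: "\<And>g. g \<in> P \<Longrightarrow> N \<inter> Z #> (x \<otimes> g) = N \<inter> Z #> (g \<otimes> x)"
    using p_group_fixes_coset[OF fin p sP cardP nN _ nK NZ] by (auto simp: N_def)
  have xG: "x \<in> carrier G" using x cP by (auto simp: N_def)
  \<comment> \<open>Once \<open>C\<close> is all of \<open>G\<close>, the element \<open>x\<close>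
    is central modulo \<open>Z\<close>, contradicting that \<open>x\<close> lies outside
    \<open>Z\<close>.\<close>
  define C where "C = {g \<in> carrier G. Z #> (x \<otimes> g) = Z #> (g \<otimes> x)}"
  have sZ: "subgroup Z G" and sK: "subgroup (N \<inter> Z) G" using nZ nK normal_imp_subgroup by auto
  have "C = carrier G"
  proof (rule eq_carrier_if_contains_sylows[OF fin])
    show "subgroup C G" unfolding C_def by (rule subgroup_commuting_mod[OF nZ xG])
    fix q :: nat assume q: "prime q"
    show "\<exists>Q\<subseteq>C. sylow_subgroup G q Q"
    proof (cases "q = p")
      case True
      have "P \<subseteq> C"
      proof
        fix g assume g: "g \<in> P"
        then have gG: "g \<in> carrier G" using cP by blast
        have "x \<otimes> g \<otimes> inv (g \<otimes> x) \<in> N \<inter> Z"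
          using xP[OF g] rcos_eq_iff[OF sK] xG gG by simp
        then show "g \<in> C" using rcos_eq_iff[OF sZ] xG gG by (simp add: C_def)
      qed
      then show ?thesis using True P by blast
    next
      case False
      obtain Q where Q: "sylow_subgroup G q Q" using ex_sylow_subgroup[OF fin q] by blast
      then have sQ: "subgroup Q G" and cardQ: "card Q = q ^ multiplicity q (order G)"
        by (auto simp: sylow_subgroup_def)
      have "Q \<subseteq> C"
      proof
        fix g assume g: "g \<in> Q"
        then have gG: "g \<in> carrier G" using sQ subgroup.subset by blast
        \<comment> \<open>This commutator lies in \<open>Q\<close> because \<open>x\<close>
          normalizes \<open>Q\<close>, and in \<open>P\<close> because \<open>N\<close> is normal
          and contained in \<open>P\<close>. The orders of \<open>P\<close> and \<open>Q\<close> are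
          coprime, so it is trivial.\<close>
        define c where "c = x \<otimes> g \<otimes> inv x \<otimes> inv g"
        have cG: "c \<in> carrier G" using xG gG by (simp add: c_def)
        have "x \<in> normalizer G Q" using Mnorm[OF _ q Q] x by (simp add: N_def)
        then have "c \<in> Q"
          using normalizer_conj_closed[OF sQ _ g] subgroup.m_inv_closed[OF sQ g] subgroup.m_closed[OF sQ]
          by (simp add: c_def)
        then have "ord c dvd card Q" using pow_card_subgroup[OF sQ] pow_eq_id[OF cG] by blast
        moreover have "c \<in> P"
          using normal_commutator_closed[OF nN x(1) gG] by (simp add: N_def c_def)
        then have "ord c dvd card P" using pow_card_subgroup[OF sP] pow_eq_id[OF cG] by blast
        moreover have "coprime (card P) (card Q)"
          using primes_coprime[OF p q] False by (simp add: cardP cardQ)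
        ultimately have "ord c = 1" by (metis coprime_common_divisor nat_dvd_1_iff_1)
        then have "c = \<one>" using ord_eq_1[OF cG] by simp
        then have "x \<otimes> g \<otimes> inv (g \<otimes> x) = \<one>" using xG gG by (simp add: c_def inv_mult_group m_assoc)
        then have "x \<otimes> g \<otimes> inv (g \<otimes> x) \<in> Z" using subgroup.one_closed[OF sZ] by simp
        then show "g \<in> C" using rcos_eq_iff[OF sZ] xG gG by (simp add: C_def)
      qed
      then show ?thesis using Q by blast
    qed
  qed
  then have "x \<in> Z"
    using mem_hypercenterI[OF fin xG] by (auto simp: C_def Z_def)
  then show False using x by blast
qed

text \<open>The preceding lemma handles elements of prime power order. Applying the Sylow criterion
  inside the group \<open>M\<close> extends it to all of \<open>M\<close>.\<close>

lemma sylow_normalizer_inter_subset_hypercenter: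
  assumes fin: "finite (carrier G)"
  shows "sylow_normalizer_inter G \<subseteq> hypercenter G"
proof -
  define M where "M = sylow_normalizer_inter G"
  have sM: "subgroup M G" and sZ: "subgroup (hypercenter G) G"
    using sylow_normalizer_inter_normal[OF fin] hypercenter_normal normal_imp_subgroup by (auto simp: M_def)
  have cM: "M \<subseteq> carrier G" using sM subgroup.subset by blast
  then have finM: "finite (carrier (G\<lparr>carrier := M\<rparr>))" using fin finite_subset by auto
  interpret M: group "G\<lparr>carrier := M\<rparr>" using sM by (rule subgroup_imp_group)
  have "M \<inter> hypercenter G = carrier (G\<lparr>carrier := M\<rparr>)"
  proof (rule M.eq_carrier_if_contains_sylows[OF finM])
    show "subgroup (M \<inter> hypercenter G) (G\<lparr>carrier := M\<rparr>)"
      using subgroups_Inter_pair[OF sM sZ] sM subgroup_incl by blast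
    fix p :: nat assume p: "prime p"
    obtain R where R: "sylow_subgroup (G\<lparr>carrier := M\<rparr>) p R"
      using M.ex_sylow_subgroup[OF finM p] by blast
    obtain P where P: "sylow_subgroup G p P" using ex_sylow_subgroup[OF fin p] by blast
    have RM: "R \<subseteq> M" using R subgroup.subset by (fastforce simp: sylow_subgroup_def)
    have sR: "subgroup R G" using R incl_subgroup[OF sM] by (auto simp: sylow_subgroup_def)
    have "R \<subseteq> hypercenter G"
    proof
      fix x assume x: "x \<in> R"
      have "x [^] card R = \<one>" using pow_card_subgroup[OF sR x] .
      then have pow: "x [^] (p ^ multiplicity p (order (G\<lparr>carrier := M\<rparr>))) = \<one>"
        using R by (simp add: sylow_subgroup_def)
      have "x \<in> normalizer G P"
        using x RM p P by (auto simp: M_def sylow_normalizer_inter_def)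
      \<comment> \<open>\<open>R\<close> and \<open>P\<close> are chosen independently;
        \<open>R\<close> still lies in \<open>P\<close> because its elements are
        \<open>p\<close>-elements normalizing \<open>P\<close>.\<close>
      then have "x \<in> P" using p_element_normalizing_sylow[OF fin p P _ pow] by blast
      then show "x \<in> hypercenter G"
        using sylow_inter_subset_hypercenter[OF fin p P] x RM by (auto simp: M_def)
    qed
    then show "\<exists>R\<subseteq>M \<inter> hypercenter G. sylow_subgroup (G\<lparr>carrier := M\<rparr>) p R"
      using R RM by blast
  qed
  then show ?thesis by (auto simp: M_def)
qed

end

theorem theorem1p1:
  fixes G (structure)
  assumes "group G" and "finite (carrier G)"
  shows "self_normalizing_norm G = hypercenter G"
proof
  interpret group G by (rule assms)
  have norm: "normalizer G H = H" if "H \<in> self_normalizing_subgroups G" for H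
    using that by (simp add: self_normalizing_subgroups_def)
  show "hypercenter G \<subseteq> self_normalizing_norm G"
    using upper_central_series_subset_self_normalizing[OF assms(2)] norm
    by (force simp: hypercenter_def self_normalizing_norm_def)
  \<comment> \<open>This member of the family bounds the intersection by \<open>carrier G\<close>,
    as membership in \<open>sylow_normalizer_inter\<close> requires.\<close>
  have "carrier G \<in> self_normalizing_subgroups G"
    using subgroup_self subgroup_subset_normalizer[OF subgroup_self]
      subgroup.subset[OF subgroup_normalizer[OF subgroup_self]]
    by (fastforce simp: self_normalizing_subgroups_def)
  \<comment> \<open>Each Sylow normalizer is self-normalizing, so it is one of the subgroups being
    intersected.\<close>
  then have "self_normalizing_norm G \<subseteq> sylow_normalizer_inter G"
    using normalizer_sylow_self_normalizing[OF assms(2)] norm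
    by (fastforce simp: self_normalizing_norm_def sylow_normalizer_inter_def)
  then show "self_normalizing_norm G \<subseteq> hypercenter G"
    using sylow_normalizer_inter_subset_hypercenter[OF assms(2)] by blast
qed

end
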